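(* Let $S$ be an epigroup in $\mathcal{W}$, i.e. a semigroup such that $xy$ is completely regular for all $x,y\in S$. Then for every $c\in S$, the primary conjugacy relation $\sim_p$ of the variant semigroup $(S,\cdot_c)$, where $x\cdot_c y=xcy$, is transitive.
   Context: An element of a semigroup is completely regular if it lies in a subgroup of the semigroup (equivalently, its $\mathcal{H}$-class is a group). $\mathcal{W}$ is the class of all semigroups $S$ such that $xy$ is completely regular for all $x,y\in S$ (such semigroups are automatically epigroups, i.e. every element has a power lying in a subgroup). For a semigroup $T$, let $T^1=T$ if $T$ is a monoid, and otherwise $T^1=T\cup\{1\}$ with $1$ an adjoined identity element. Elements $a,b\in T$ are primarily conjugate, written $a\sim_p b$, if there exist $x,y\in T^1$ such that $a=xy$ and $b=yx$ (products in $T^1$). Here this definition is applied to $T=(S,\cdot_c)$. *)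

theory Defs
  imports "HOL-Algebra.Group"
begin

text \<open>
  A semigroup is given by an associative operation on a type (locale \<^locale>\<open>semigroup\<close>), so that
  one type can carry both a semigroup and its variants.
\<close>

definition subgroup_of_semigroup :: "('a \<Rightarrow> 'a \<Rightarrow> 'a) \<Rightarrow> 'a set \<Rightarrow> bool" where
  "subgroup_of_semigroup f G \<longleftrightarrow> (\<exists>e. Group.group \<lparr>carrier = G, monoid.mult = f, one = e\<rparr>)"

definition completely_regular :: "('a \<Rightarrow> 'a \<Rightarrow> 'a) \<Rightarrow> 'a \<Rightarrow> bool" where
  "completely_regular f a \<longleftrightarrow> (\<exists>G. subgroup_of_semigroup f G \<and> a \<in> G)"

text \<open>
  The class \<open>\<W>\<close>. Its members are automatically epigroups: each square \<open>f x x\<close> lies in a subgroup.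
\<close>

definition in_W :: "('a \<Rightarrow> 'a \<Rightarrow> 'a) \<Rightarrow> bool" where
  "in_W f \<longleftrightarrow> semigroup f \<and> (\<forall>x y. completely_regular f (f x y))"

definition variant :: "('a \<Rightarrow> 'a \<Rightarrow> 'a) \<Rightarrow> 'a \<Rightarrow> 'a \<Rightarrow> 'a \<Rightarrow> 'a" where
  "variant f c x y = f (f x c) y"

text \<open>
  \<open>T\<^sup>1\<close> is a subset of the option type: \<open>Some\<close> embeds \<open>T\<close>, and \<open>None\<close> is the adjoined identity,
  which belongs to \<open>T\<^sup>1\<close> only if \<open>T\<close> has no identity of its own.
\<close>

definition carrier1 :: "('a \<Rightarrow> 'a \<Rightarrow> 'a) \<Rightarrow> 'a option set" where
  "carrier1 f = (if \<exists>e. Groups.monoid f e then range Some else insert None (range Some))"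

fun mult1 :: "('a \<Rightarrow> 'a \<Rightarrow> 'a) \<Rightarrow> 'a option \<Rightarrow> 'a option \<Rightarrow> 'a option" where
  "mult1 f None y = y"
| "mult1 f x None = x"
| "mult1 f (Some x) (Some y) = Some (f x y)"

definition primarily_conjugate :: "('a \<Rightarrow> 'a \<Rightarrow> 'a) \<Rightarrow> 'a \<Rightarrow> 'a \<Rightarrow> bool" where
  "primarily_conjugate f a b \<longleftrightarrow>
     (\<exists>x\<in>carrier1 f. \<exists>y\<in>carrier1 f. Some a = mult1 f x y \<and> Some b = mult1 f y x)"

end

theory Submission
  imports Defs
begin

text \<open>
  If \<open>a = xy\<close>, \<open>b = yx = uv\<close> and \<open>d = vu\<close> are completely regular and \<open>b'\<close> is the group inverse
  of \<open>b\<close>, then \<open>p = xu\<close> and \<open>q = vb'y\<close> satisfy \<open>pq = a\<close> and \<open>qp = d\<close>, because \<open>x\<close> and \<open>v\<close>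
  intertwine the group inverses: \<open>a'x = xb'\<close> and \<open>d'v = vb'\<close>. It remains to see that products in
  the variant are completely regular. For \<open>a = xcy\<close>, complete regularity of \<open>cy\<close> puts \<open>a\<close> into
  \<open>acS\<close>; hence \<open>a\<close> is fixed by the identity of the subgroup containing \<open>ac\<close>, and
  \<open>(ac)'(ac)'a\<close> is a group inverse of \<open>a\<close> in the variant.
\<close>

text \<open>Three equations in place of a subgroup, so that an inverse in the variant can be
  verified by direct computation.\<close>

definition group_inverse :: "('a \<Rightarrow> 'a \<Rightarrow> 'a) \<Rightarrow> 'a \<Rightarrow> 'a \<Rightarrow> bool" where
  "group_inverse f a t \<longleftrightarrow> f a t = f t a \<and> f (f a t) a = a \<and> f (f t a) t = t"

lemma completely_regular_imp_group_inverse: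
  assumes "completely_regular f a"
  obtains t where "group_inverse f a t"
proof -
  obtain G e where "Group.group \<lparr>carrier = G, monoid.mult = f, one = e\<rparr>" and a: "a \<in> G"
    using assms unfolding completely_regular_def subgroup_of_semigroup_def by blast
  then interpret G: Group.group "\<lparr>carrier = G, monoid.mult = f, one = e\<rparr>" by simp
  let ?t = "inv\<^bsub>\<lparr>carrier = G, monoid.mult = f, one = e\<rparr>\<^esub> a"
  have "?t \<in> G" "f a ?t = e" "f ?t a = e" "f e a = a" "f e ?t = ?t"
    using a G.inv_closed[of a] G.r_inv[of a] G.l_inv[of a] G.l_one[of a] G.l_one[of ?t] by simp_all
  then have "group_inverse f a ?t" by (simp add: group_inverse_def)
  then show thesis by (rule that)
qed

lemma semigroup_variant:
  assumes "semigroup f"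
  shows "semigroup (variant f c)"
proof -
  interpret semigroup f by fact
  show ?thesis by unfold_locales (simp add: variant_def assoc)
qed

context semigroup
begin

text \<open>Both sides equal \<open>a'axb'\<close>: since \<open>ax = xb\<close>, the product
  \<open>a'x\<close> absorbs \<open>bb'\<close> on the right and \<open>xb'\<close> absorbs
  \<open>a'a\<close> on the left.\<close>

lemma group_inverse_intertwine:
  assumes a': "group_inverse f (x \<^bold>* y) a'" and b': "group_inverse f (y \<^bold>* x) b'"
  shows "a' \<^bold>* x = x \<^bold>* b'"
proof -
  define a b where "a = x \<^bold>* y" and "b = y \<^bold>* x"
  have ax: "a \<^bold>* x = x \<^bold>* b" by (simp add: a_def b_def assoc)
  have A: "a \<^bold>* a' = a' \<^bold>* a" "a' \<^bold>* a \<^bold>* a' = a'"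
    and B: "b \<^bold>* b' = b' \<^bold>* b" "b \<^bold>* b' \<^bold>* b = b" "b' \<^bold>* b \<^bold>* b' = b'" "a \<^bold>* a' \<^bold>* a = a"
    using a' b' unfolding group_inverse_def a_def b_def by blast+
  have "a' \<^bold>* x = a' \<^bold>* a' \<^bold>* (a \<^bold>* x)" using A by (metis assoc)
  also have "\<dots> = a' \<^bold>* a' \<^bold>* (a \<^bold>* x) \<^bold>* (b \<^bold>* b')" unfolding ax using B by (metis assoc)
  also have "\<dots> = a' \<^bold>* x \<^bold>* b \<^bold>* b'" using A by (metis assoc)
  also have "\<dots> = a' \<^bold>* a \<^bold>* x \<^bold>* b'" using ax by (metis assoc)
  also have "\<dots> = a' \<^bold>* a \<^bold>* (x \<^bold>* b) \<^bold>* b' \<^bold>* b'" using B by (metis assoc)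
  also have "\<dots> = a \<^bold>* x \<^bold>* b' \<^bold>* b'" unfolding ax[symmetric] using A B by (metis assoc)
  also have "\<dots> = x \<^bold>* b'" using ax B by (metis assoc)
  finally show ?thesis .
qed

text \<open>Moving \<open>b'\<close> leftwards across \<open>x\<close> turns it into
  \<open>a'\<close>, which leaves \<open>aa'a = a\<close>.\<close>

lemma group_inverse_sandwich:
  assumes a': "group_inverse f (x \<^bold>* y) a'" and b': "group_inverse f (y \<^bold>* x) b'"
  shows "x \<^bold>* (y \<^bold>* x) \<^bold>* b' \<^bold>* y = x \<^bold>* y"
proof -
  have "x \<^bold>* (y \<^bold>* x) \<^bold>* b' \<^bold>* y = (x \<^bold>* y) \<^bold>* (x \<^bold>* b') \<^bold>* y" by (simp add: assoc)
  also have "\<dots> = (x \<^bold>* y) \<^bold>* a' \<^bold>* (x \<^bold>* y)"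
    by (simp add: group_inverse_intertwine[OF a' b', symmetric] assoc)
  also have "\<dots> = x \<^bold>* y" using a' unfolding group_inverse_def by blast
  finally show ?thesis .
qed

lemma swapped_factors_trans:
  assumes inv: "\<And>x y. \<exists>t. group_inverse f (x \<^bold>* y) t"
    and b: "y \<^bold>* x = u \<^bold>* v"
  shows "\<exists>p q. x \<^bold>* y = p \<^bold>* q \<and> v \<^bold>* u = q \<^bold>* p"
proof -
  obtain a' b' d' where a': "group_inverse f (x \<^bold>* y) a'"
    and b': "group_inverse f (y \<^bold>* x) b'" and d': "group_inverse f (v \<^bold>* u) d'"
    using inv by meson
  let ?p = "x \<^bold>* u" and ?q = "v \<^bold>* b' \<^bold>* y"
  have "?p \<^bold>* ?q = x \<^bold>* (y \<^bold>* x) \<^bold>* b' \<^bold>* y" unfolding b by (simp add: assoc)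
  also have "\<dots> = x \<^bold>* y" by (rule group_inverse_sandwich[OF a' b'])
  finally have pq: "?p \<^bold>* ?q = x \<^bold>* y" .
  have "?q \<^bold>* ?p = v \<^bold>* (b' \<^bold>* (y \<^bold>* x)) \<^bold>* u" by (simp add: assoc)
  \<comment> \<open>Once \<open>b'\<close> has moved past \<open>b\<close>, reading \<open>b\<close>
    as \<open>uv\<close> instead of \<open>yx\<close> gives the sandwich with \<open>v\<close>,
    \<open>u\<close> as factors.\<close>
  also have "\<dots> = v \<^bold>* ((y \<^bold>* x) \<^bold>* b') \<^bold>* u" using b' unfolding group_inverse_def by metis
  also have "\<dots> = v \<^bold>* (u \<^bold>* v) \<^bold>* b' \<^bold>* u" unfolding b by (simp add: assoc)
  also have "\<dots> = v \<^bold>* u" by (rule group_inverse_sandwich[OF d' b'[unfolded b]])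
  finally show ?thesis using pq by metis
qed

lemma variant_group_inverse:
  assumes inv: "\<And>x y. \<exists>t. group_inverse f (x \<^bold>* y) t"
  shows "\<exists>t. group_inverse (variant f c) (variant f c x y) t"
proof -
  define a where "a = x \<^bold>* c \<^bold>* y"
  obtain r s where r: "group_inverse f (c \<^bold>* y) r" and s: "group_inverse f (a \<^bold>* c) s"
    using inv by meson
  have S: "a \<^bold>* c \<^bold>* s = s \<^bold>* (a \<^bold>* c)" "a \<^bold>* c \<^bold>* s \<^bold>* (a \<^bold>* c) = a \<^bold>* c" "s \<^bold>* (a \<^bold>* c) \<^bold>* s = s"
    using s unfolding group_inverse_def by blast+
  \<comment> \<open>This puts \<open>a\<close> into \<open>acS\<close>, where the idempotent
    \<open>s(ac)\<close> acts as a left identity.\<close>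
  have "c \<^bold>* y = c \<^bold>* y \<^bold>* (c \<^bold>* y) \<^bold>* r" using r unfolding group_inverse_def by (metis assoc)
  then have "a = a \<^bold>* c \<^bold>* (y \<^bold>* r)" unfolding a_def by (metis assoc)
  then have fixed: "s \<^bold>* (a \<^bold>* c) \<^bold>* a = a" using S by (metis assoc)
  \<comment> \<open>In the variant, \<open>sa\<close> is the identity of the subgroup around
    \<open>a\<close>; the further factor \<open>s\<close> makes both variant products of
    \<open>a\<close> and \<open>?t\<close> equal to \<open>sa\<close>.\<close>
  let ?t = "s \<^bold>* s \<^bold>* a"
  have at: "a \<^bold>* c \<^bold>* ?t = s \<^bold>* a" and ta: "?t \<^bold>* c \<^bold>* a = s \<^bold>* a"
    using S fixed by (metis assoc)+
  have "s \<^bold>* a \<^bold>* c \<^bold>* a = a" "s \<^bold>* a \<^bold>* c \<^bold>* ?t = ?t"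
    using S fixed by (metis assoc)+
  with at ta have "group_inverse (variant f c) a ?t"
    by (simp add: group_inverse_def variant_def)
  then show ?thesis by (auto simp: variant_def a_def)
qed

end

lemma primarily_conjugate_swap: "primarily_conjugate f (f x y) (f y x)"
  unfolding primarily_conjugate_def carrier1_def
  by (rule bexI[of _ "Some x"], rule bexI[of _ "Some y"]) auto

text \<open>If a factor is the adjoined identity, both products equal the other factor, hence
  \<open>a = b\<close>. This treats semigroups with and without identity uniformly.\<close>

lemma primarily_conjugate_cases:
  assumes "primarily_conjugate f a b"
  obtains "a = b" | x y where "a = f x y" "b = f y x"
proof -
  obtain x y where "Some a = mult1 f x y" "Some b = mult1 f y x"
    using assms unfolding primarily_conjugate_def by blast
  then show thesis using that by (cases x; cases y) auto
qed

theorem corollary11: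
  fixes f :: "'a \<Rightarrow> 'a \<Rightarrow> 'a" and c :: 'a
  assumes "in_W f"
  shows "transp (primarily_conjugate (variant f c))"
proof (rule transpI)
  interpret semigroup f using assms by (simp add: in_W_def)
  \<comment> \<open>Group inverses are built from those of \<open>f\<close>, but the exchange of
    factors takes place inside the variant.\<close>
  interpret V: semigroup "variant f c" by (rule semigroup_variant) unfold_locales
  have "\<exists>t. group_inverse f (f x y) t" for x y
    using assms completely_regular_imp_group_inverse unfolding in_W_def by metis
  then have inv: "\<exists>t. group_inverse (variant f c) (variant f c x y) t" for x y
    by (rule variant_group_inverse)
  fix a b d
  assume ab: "primarily_conjugate (variant f c) a b" and bd: "primarily_conjugate (variant f c) b d"
  show "primarily_conjugate (variant f c) a d"
    using ab
  proof (cases rule: primarily_conjugate_cases)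
    case 1
    then show ?thesis using bd by simp
  next
    case xy: (2 x y)
    show ?thesis
      using bd
    proof (cases rule: primarily_conjugate_cases)
      case 1
      then show ?thesis using ab by simp
    next
      case (2 u v)
      then obtain p q where "a = variant f c p q" "d = variant f c q p"
        using V.swapped_factors_trans[OF inv, of y x u v] xy by auto
      then show ?thesis by (simp add: primarily_conjugate_swap)
    qed
  qed
qed

end
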